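(* For any Boolean function $f:\{0,1\}^n\to\{0,1\}$ and any Boolean circuit $C$ over the basis $\{\land_2,\lor_2,\lnot\}$ computing $f$, $\mathsf{EC}(C)\ge \mathsf{psens}(f)/3$.
   Context: A Boolean circuit $C$ over the basis $\{\land_2,\lor_2,\lnot\}$ (AND and OR of fan-in 2, and NOT) is a directed acyclic graph with a root node of out-degree zero, input gates (in-degree zero) labeled by variables $x_1,\dots,x_n$, and non-input gates (including the root, so the root is never an input gate) labeled by functions in the basis; gates may have arbitrary fan-out. For $a\in\{0,1\}^n$, $\mathsf{EC}(C,a)$ is the number of non-input gates of $C$ that output $1$ on $a$, and $\mathsf{EC}(C)=\max_{a\in\{0,1\}^n}\mathsf{EC}(C,a)$. For $a\in\{0,1\}^n$, $a\oplus e_i$ is $a$ with the $i$-th bit flipped. The positive sensitivity of $f$ on $a$, $\mathsf{psens}(f,a)$, is the number of $i\in\{1,\dots,n\}$ such that $a_i=1$ and $f(a\oplus e_i)\ne f(a)$; $\mathsf{psens}(f)=\max_{a\in\{0,1\}^n}\mathsf{psens}(f,a)$. *)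

theory Defs
  imports Complex_Main
begin

definition cube :: "nat \<Rightarrow> bool list set" where
  "cube n = {a. length a = n}"

text \<open>The coordinates \<open>1, \<dots>, n\<close> of a point are the list positions \<open>0, \<dots>, n - 1\<close>, so
  \<open>a ! i\<close> is the bit \<open>a\<^sub>i\<^sub>+\<^sub>1\<close>, and \<open>Input i\<close> below stands for the variable \<open>x\<^sub>i\<^sub>+\<^sub>1\<close>.\<close>

definition flip :: "nat \<Rightarrow> bool list \<Rightarrow> bool list" where
  "flip i a = a[i := \<not> a ! i]"

definition psens_at :: "nat \<Rightarrow> (bool list \<Rightarrow> bool) \<Rightarrow> bool list \<Rightarrow> nat" where
  "psens_at n f a = card {i. i < n \<and> a ! i \<and> f (flip i a) \<noteq> f a}"

definition psens :: "nat \<Rightarrow> (bool list \<Rightarrow> bool) \<Rightarrow> nat" where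
  "psens n f = Max (psens_at n f ` cube n)"

text \<open>A gate carries its label together with the tails of its incoming wires. The two wires
  entering an \<open>And\<close> or \<open>Or\<close> gate may come from the same node (parallel wires). Several input
  gates may carry the same variable.\<close>

datatype 'v gate = Input nat | And 'v 'v | Or 'v 'v | Neg 'v

record 'v circuit =
  nodes :: "'v set"
  gate_of :: "'v \<Rightarrow> 'v gate"
  root :: 'v

definition wires :: "'v circuit \<Rightarrow> ('v \<times> 'v) set" where
  "wires C = {(u, v). v \<in> nodes C \<and> u \<in> set_gate (gate_of C v)}"

definition non_input :: "'v circuit \<Rightarrow> 'v \<Rightarrow> bool" where
  "non_input C v \<longleftrightarrow> (\<forall>i. gate_of C v \<noteq> Input i)"

definition is_circuit :: "nat \<Rightarrow> 'v circuit \<Rightarrow> bool" where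
  "is_circuit n C \<longleftrightarrow>
     finite (nodes C) \<and>
     wires C \<subseteq> nodes C \<times> nodes C \<and>
     acyclic (wires C) \<and>
     (\<forall>v\<in>nodes C. \<forall>i. gate_of C v = Input i \<longrightarrow> i < n) \<and>
     root C \<in> nodes C \<and> non_input C (root C) \<and> root C \<notin> Domain (wires C)"

text \<open>\<open>outputs C a v b\<close>: node \<open>v\<close> of \<open>C\<close> outputs the bit \<open>b\<close> on \<open>a\<close>.\<close>

inductive outputs :: "'v circuit \<Rightarrow> bool list \<Rightarrow> 'v \<Rightarrow> bool \<Rightarrow> bool" for C a where
  Input: "gate_of C v = Input i \<Longrightarrow> outputs C a v (a ! i)"
| And: "gate_of C v = And u w \<Longrightarrow> outputs C a u b \<Longrightarrow> outputs C a w c \<Longrightarrow> outputs C a v (b \<and> c)"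
| Or: "gate_of C v = Or u w \<Longrightarrow> outputs C a u b \<Longrightarrow> outputs C a w c \<Longrightarrow> outputs C a v (b \<or> c)"
| Neg: "gate_of C v = Neg u \<Longrightarrow> outputs C a u b \<Longrightarrow> outputs C a v (\<not> b)"

definition computes :: "nat \<Rightarrow> 'v circuit \<Rightarrow> (bool list \<Rightarrow> bool) \<Rightarrow> bool" where
  "computes n C f \<longleftrightarrow> (\<forall>a\<in>cube n. outputs C a (root C) (f a))"

definition EC_at :: "'v circuit \<Rightarrow> bool list \<Rightarrow> nat" where
  "EC_at C a = card {v \<in> nodes C. non_input C v \<and> outputs C a v True}"

definition EC :: "nat \<Rightarrow> 'v circuit \<Rightarrow> nat" where
  "EC n C = Max (EC_at C ` cube n)"

text \<open>The maxima above range over finite nonempty sets, and every node of a circuit outputs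
  exactly one bit.\<close>

lemma finite_cube: "finite (cube n)"
  using finite_lists_length_eq[of "UNIV :: bool set" n] by (simp add: cube_def)

lemma cube_nonempty: "cube n \<noteq> {}"
  by (auto simp: cube_def intro: exI[of _ "replicate n True"])

lemma flip_in_cube: "a \<in> cube n \<Longrightarrow> flip i a \<in> cube n"
  by (simp add: cube_def flip_def)

lemma outputs_deterministic: "outputs C a v b \<Longrightarrow> outputs C a v c \<Longrightarrow> b = c"
proof (induction arbitrary: c rule: outputs.induct)
  case (Input v i)
  from Input.prems Input.hyps show ?case by (cases rule: outputs.cases) auto
next
  case (And v u w b1 b2)
  from And.prems obtain c1 c2 where "outputs C a u c1" "outputs C a w c2" "c = (c1 \<and> c2)"
    using And.hyps(1) by (cases rule: outputs.cases) simp_all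
  with And.IH show ?case by blast
next
  case (Or v u w b1 b2)
  from Or.prems obtain c1 c2 where "outputs C a u c1" "outputs C a w c2" "c = (c1 \<or> c2)"
    using Or.hyps(1) by (cases rule: outputs.cases) simp_all
  with Or.IH show ?case by blast
next
  case (Neg v u b1)
  from Neg.prems obtain c1 where "outputs C a u c1" "c = (\<not> c1)"
    using Neg.hyps(1) by (cases rule: outputs.cases) simp_all
  with Neg.IH show ?case by blast
qed

lemma outputs_ex1:
  assumes C: "is_circuit n C" and v: "v \<in> nodes C"
  shows "\<exists>!b. outputs C a v b"
proof -
  have "finite (wires C)"
    using C by (auto simp: is_circuit_def intro: finite_subset)
  then have "wf (wires C)"
    using C by (simp add: is_circuit_def finite_acyclic_wf)
  then have "v \<in> nodes C \<longrightarrow> (\<exists>b. outputs C a v b)"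
  proof (induction v rule: wf_induct_rule)
    case (less v)
    have IH: "\<exists>b. outputs C a u b" if "v \<in> nodes C" "u \<in> set_gate (gate_of C v)" for u
    proof -
      have "(u, v) \<in> wires C" using that by (simp add: wires_def)
      moreover from this have "u \<in> nodes C" using C by (auto simp: is_circuit_def)
      ultimately show ?thesis using less by blast
    qed
    show ?case
    proof (cases "gate_of C v")
      case (Input i)
      then show ?thesis by (auto intro: outputs.Input)
    next
      case (And u w)
      then show ?thesis using IH[of u] IH[of w] outputs.And by (metis gate.set_intros)
    next
      case (Or u w)
      then show ?thesis using IH[of u] IH[of w] outputs.Or by (metis gate.set_intros)
    next
      case (Neg u)
      then show ?thesis using IH[of u] by (auto intro: outputs.Neg)
    qed
  qed
  then obtain b where "outputs C a v b" using v by blast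
  then show ?thesis
    by (rule ex1I) (rule outputs_deterministic[OF _ \<open>outputs C a v b\<close>])
qed

end

theory Submission
  imports Defs
begin

text \<open>If flipping a bit \<open>a\<^sub>i = 1\<close> changes the root, then an input gate labelled \<open>x\<^sub>i\<close> feeds either a
  negation or a gate that outputs 1 on \<open>a\<close>: a conjunction or disjunction outputting 0 on \<open>a\<close> cannot
  react to a wire dropping from 1 to 0. A gate has at most two incoming wires, so at most
  \<open>2 \<cdot> EC(C, a)\<close> indices are of the second kind. Every index of the first kind owns a negation that
  outputs 1 on the zero vector, so there are at most \<open>EC(C, 0)\<close> of them.\<close>

definition fired :: "'v circuit \<Rightarrow> bool list \<Rightarrow> 'v set" where
  "fired C a = {v \<in> nodes C. non_input C v \<and> outputs C a v True}"

text \<open>Indices are collected rather than input gates, because several input gates may carry the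
  same variable while \<open>psens\<close> counts each variable once.\<close>

definition feeding_vars :: "'v circuit \<Rightarrow> 'v \<Rightarrow> nat set" where
  "feeding_vars C v = {i. \<exists>u\<in>set_gate (gate_of C v). gate_of C u = Input i}"

lemma feeding_vars_Neg:
  assumes "gate_of C v = Neg u" "gate_of C u = Input i"
  shows "feeding_vars C v = {i}"
  using assms by (auto simp: feeding_vars_def)

lemma finite_feeding_vars: "finite (feeding_vars C v)"
  and card_feeding_vars_le: "card (feeding_vars C v) \<le> 2"
proof -
  \<comment> \<open>On a child that is not an input gate the value of \<open>idx\<close> is
    arbitrary. This is harmless, since only an inclusion into the image is claimed.\<close>
  define idx where "idx u = (THE i. gate_of C u = Input i)" for u
  have sub: "feeding_vars C v \<subseteq> idx ` set_gate (gate_of C v)"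
    by (force simp: feeding_vars_def idx_def)
  have set_gate: "finite (set_gate (gate_of C v))" "card (set_gate (gate_of C v)) \<le> 2"
    by (cases "gate_of C v"; simp add: card_insert_if)+
  show "finite (feeding_vars C v)"
    using sub set_gate(1) by (meson finite_imageI finite_subset)
  show "card (feeding_vars C v) \<le> 2"
    using surj_card_le[OF set_gate(1) sub] set_gate(2) by simp
qed

lemma EC_at_le_EC: "a \<in> cube n \<Longrightarrow> EC_at C a \<le> EC n C"
  unfolding EC_def by (intro Max_ge) (auto simp: finite_cube)

text \<open>Induction along the evaluation on \<open>a\<close>. Nodes labelled
  \<open>Input i\<close> do change and are excluded, so the induction hypothesis is missing exactly
  at wires leaving them. Such wires carry 1 on \<open>a\<close>, and the hypotheses let them enter
  only conjunctions that output 0.\<close>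

lemma outputs_flip_cong:
  assumes C: "is_circuit n C" and ai: "a ! i"
    and no_Neg: "\<And>v u. v \<in> nodes C \<Longrightarrow> gate_of C v = Neg u \<Longrightarrow> gate_of C u \<noteq> Input i"
    and no_fired: "\<And>v. v \<in> fired C a \<Longrightarrow> i \<notin> feeding_vars C v"
    and "outputs C a v b" "v \<in> nodes C" "gate_of C v \<noteq> Input i"
  shows "outputs C (flip i a) v b"
proof -
  have child: "u \<in> nodes C" if "v \<in> nodes C" "u \<in> set_gate (gate_of C v)" for u v
    using C that by (auto simp: is_circuit_def wires_def)
  have var_True: "b" if "outputs C a u b" "gate_of C u = Input i" for u b
    using outputs_deterministic[OF outputs.Input[OF that(2)] that(1)] ai by simp
  have flip_ex: "\<exists>b. outputs C (flip i a) u b" if "u \<in> nodes C" for u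
    using outputs_ex1[OF C that] by blast
  show ?thesis
    using assms(5-7)
  proof (induction rule: outputs.induct)
    case (Input v j)
    then have "flip i a ! j = a ! j" by (auto simp: flip_def)
    then show ?case using outputs.Input[OF Input.hyps, of "flip i a"] by simp
  next
    case (And v u w b c)
    have ch: "u \<in> nodes C" "w \<in> nodes C"
      using child[OF And.prems(1)] And.hyps(1) by simp_all
    show ?case
    proof (cases "gate_of C u = Input i \<or> gate_of C w = Input i")
      case False
      then show ?thesis
        using outputs.And[OF And.hyps(1) And.IH] ch by blast
    next
      case True
      then have "v \<notin> fired C a"
        using no_fired[of v] And.hyps(1) by (auto simp: feeding_vars_def)
      moreover have "non_input C v"
        using And.hyps(1) by (simp add: non_input_def)
      ultimately have bc: "\<not> (b \<and> c)"
        using outputs.And[OF And.hyps] And.prems(1) by (cases "b \<and> c") (simp_all add: fired_def)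
      \<comment> \<open>Some wire carries 0 on \<open>a\<close>. It cannot come from an
        \<open>Input i\<close> node, so the induction hypothesis keeps it at 0, which forces the
        conjunction to 0 whatever the other wire does.\<close>
      have "outputs C (flip i a) u False \<or> outputs C (flip i a) w False"
      proof (cases b)
        case True
        then have "gate_of C w \<noteq> Input i" using bc var_True[OF And.hyps(3)] by blast
        then show ?thesis using And.IH(2)[OF ch(2)] bc True by simp
      next
        case False
        then have "gate_of C u \<noteq> Input i" using var_True[OF And.hyps(2)] by blast
        then show ?thesis using And.IH(1)[OF ch(1)] False by simp
      qed
      then have "outputs C (flip i a) v False"
      proof
        assume "outputs C (flip i a) u False"
        from flip_ex[OF ch(2)] outputs.And[OF And.hyps(1) this] show ?thesis by auto
      next
        assume w: "outputs C (flip i a) w False"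
        from flip_ex[OF ch(1)] outputs.And[OF And.hyps(1) _ w] show ?thesis by auto
      qed
      then show ?thesis by (simp only: bc)
    qed
  next
    case (Or v u w b c)
    have ch: "u \<in> nodes C" "w \<in> nodes C"
      using child[OF Or.prems(1)] Or.hyps(1) by simp_all
    \<comment> \<open>A disjunction reading the flipped variable would output 1 on \<open>a\<close>
      and hence be fired, against \<open>no_fired\<close>.\<close>
    have "gate_of C u \<noteq> Input i \<and> gate_of C w \<noteq> Input i"
    proof (rule ccontr)
      assume fed: "\<not> ?thesis"
      then have "b \<or> c"
        using var_True[OF Or.hyps(2)] var_True[OF Or.hyps(3)] by blast
      then have "v \<in> fired C a"
        using outputs.Or[OF Or.hyps] Or.prems(1) Or.hyps(1) by (simp add: fired_def non_input_def)
      moreover have "i \<in> feeding_vars C v"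
        using fed Or.hyps(1) by (auto simp: feeding_vars_def)
      ultimately show False using no_fired by blast
    qed
    then show ?case
      using outputs.Or[OF Or.hyps(1) Or.IH] ch by blast
  next
    case (Neg v u b)
    have "u \<in> nodes C" "gate_of C u \<noteq> Input i"
      using child[OF Neg.prems(1)] no_Neg[OF Neg.prems(1)] Neg.hyps(1) by simp_all
    then show ?case using outputs.Neg[OF Neg.hyps(1) Neg.IH] by blast
  qed
qed

text \<open>The root is never an input gate, so if both alternatives failed,
  \<open>outputs_flip_cong\<close> would carry the value \<open>f a\<close> at the root over to
  \<open>flip i a\<close>.\<close>

lemma sensitive_var_feeds:
  assumes C: "is_circuit n C" and f: "computes n C f" and a: "a \<in> cube n"
    and "a ! i" "f (flip i a) \<noteq> f a"
  shows "(\<exists>v\<in>nodes C. \<exists>u. gate_of C v = Neg u \<and> gate_of C u = Input i) \<or>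
         (\<exists>v\<in>fired C a. i \<in> feeding_vars C v)"
proof (rule ccontr)
  assume none: "\<not> ?thesis"
  have root: "root C \<in> nodes C" "gate_of C (root C) \<noteq> Input i"
    using C by (auto simp: is_circuit_def non_input_def)
  have "outputs C (flip i a) (root C) (f a)"
    using none f a root by (intro outputs_flip_cong[OF C \<open>a ! i\<close>]) (auto simp: computes_def)
  moreover have "outputs C (flip i a) (root C) (f (flip i a))"
    using f flip_in_cube[OF a] by (simp add: computes_def)
  ultimately have "f a = f (flip i a)"
    by (rule outputs_deterministic)
  then show False using assms(5) by simp
qed

text \<open>A union bound over gates. The two families of gates are fired at different points,
  \<open>z\<close> and \<open>a\<close>, but \<open>EC\<close> maximises over the cube and so bounds
  the size of each.\<close>

lemma psens_at_le:
  assumes C: "is_circuit n C" and f: "computes n C f" and a: "a \<in> cube n"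
  shows "psens_at n f a \<le> 3 * EC n C"
proof -
  define z where "z = replicate n False"
  \<comment> \<open>Membership in \<open>fired C z\<close> is built in so that \<open>card N\<close>
    is bounded by \<open>EC n C\<close> at once. That \<open>N\<close> contains the negations
    reading a sensitive variable is checked below.\<close>
  define N where "N = {v \<in> fired C z. \<exists>u i. gate_of C v = Neg u \<and> gate_of C u = Input i}"
  have z: "z \<in> cube n" by (simp add: z_def cube_def)
  have fin: "finite (fired C b)" for b
    using C by (auto simp: fired_def is_circuit_def)
  have card_fired: "card (fired C b) \<le> EC n C" if "b \<in> cube n" for b
    using EC_at_le_EC[OF that, of C] by (simp add: EC_at_def fired_def)
  have finN: "finite N" using fin by (simp add: N_def)
  have "{i. i < n \<and> a ! i \<and> f (flip i a) \<noteq> f a}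
      \<subseteq> (\<Union>v\<in>N. feeding_vars C v) \<union> (\<Union>v\<in>fired C a. feeding_vars C v)"
  proof
    fix i assume i: "i \<in> {i. i < n \<and> a ! i \<and> f (flip i a) \<noteq> f a}"
    then consider v u where "v \<in> nodes C" "gate_of C v = Neg u" "gate_of C u = Input i"
      | v where "v \<in> fired C a" "i \<in> feeding_vars C v"
      using sensitive_var_feeds[OF C f a] by blast
    then show "i \<in> (\<Union>v\<in>N. feeding_vars C v) \<union> (\<Union>v\<in>fired C a. feeding_vars C v)"
    proof cases
      case 1
      \<comment> \<open>The bound \<open>i < n\<close> from the sensitivity set guarantees that
        \<open>z ! i\<close> is a genuine entry of \<open>z\<close>.\<close>
      have "outputs C z u False"
        using outputs.Input[OF 1(3), of z] i by (simp add: z_def)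
      then have "outputs C z v True"
        using outputs.Neg[OF 1(2)] by force
      then have "v \<in> N"
        using 1 by (auto simp: N_def fired_def non_input_def)
      then show ?thesis using feeding_vars_Neg[OF 1(2,3)] by blast
    qed blast
  qed
  then have "psens_at n f a
      \<le> card ((\<Union>v\<in>N. feeding_vars C v) \<union> (\<Union>v\<in>fired C a. feeding_vars C v))"
    unfolding psens_at_def by (intro card_mono) (auto simp: fin finN finite_feeding_vars)
  also have "\<dots> \<le> card (\<Union>v\<in>N. feeding_vars C v) + card (\<Union>v\<in>fired C a. feeding_vars C v)"
    by (rule card_Un_le)
  also have "card (\<Union>v\<in>N. feeding_vars C v) \<le> (\<Sum>v\<in>N. card (feeding_vars C v))"
    by (rule card_UN_le[OF finN])
  \<comment> \<open>A negation has a single incoming wire and accounts for one index; with two per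
    gate fired on \<open>a\<close>, this yields the factor 3.\<close>
  also have "\<dots> = card N"
  proof -
    have "card (feeding_vars C v) = 1" if "v \<in> N" for v
      using that feeding_vars_Neg[of C v] by (auto simp: N_def)
    then show ?thesis by simp
  qed
  also have "\<dots> \<le> EC n C"
    using card_mono[OF fin, of N z] card_fired[OF z] by (auto simp: N_def)
  also have "card (\<Union>v\<in>fired C a. feeding_vars C v) \<le> (\<Sum>v\<in>fired C a. card (feeding_vars C v))"
    by (rule card_UN_le[OF fin])
  also have "\<dots> \<le> card (fired C a) * 2"
    using sum_bounded_above[of "fired C a" "\<lambda>v. card (feeding_vars C v)" 2]
    by (simp add: card_feeding_vars_le)
  also have "\<dots> \<le> EC n C * 2"
    using card_fired[OF a] by simp
  finally show ?thesis by simp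
qed

theorem theorem1p2:
  fixes n :: nat and f :: "bool list \<Rightarrow> bool" and C :: "'v circuit"
  assumes "is_circuit n C"
    and "computes n C f"
  shows "real (EC n C) \<ge> real (psens n f) / 3"
proof -
  have "psens n f \<le> 3 * EC n C"
    using psens_at_le[OF assms] by (simp add: psens_def finite_cube cube_nonempty)
  then show ?thesis by linarith
qed

end
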